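(* Let $B, N, K$ be positive integers with $K \le N$. For each $j \in \{1,\dots,B\}$ let $v^{(j)}(1) \ge v^{(j)}(2) \ge \cdots \ge v^{(j)}(N)$ be the confidence scores, in $[0,1]$ and sorted in descending order, of the $N$ candidate nodes of sample $j$ in a given layer of the draft tree. For $k \in \{1,\dots,N\}$ define $$u_k = \frac{1}{B}\sum_{j=1}^{B}\sum_{s=1}^{k} v^{(j)}(s),$$ and assume that $u_1 < u_2 < \cdots < u_N$. Let $\lambda > 0$ and $\delta \in \mathbb{R}$, and set $$c_k = \lambda k + \delta \quad (1 \le k \le N), \qquad C_1 = \frac{\sum_{j=1}^{B} v^{(j)}(K)}{B\lambda}.$$ Then the Select Maximum Valid Index algorithm, run on the arrays $u = (u_1,\dots,u_N)$ and $c = (c_1,\dots,c_N)$ with threshold constant $C = C_1$, outputs $K$. Consequently, the layer-selection rule of EAGLE-2 and EAGLE-3 (retain the top $K$ nodes of each sample in the layer) is the special case of the algorithm's selection rule (retain the top $n$ nodes of each sample, where $n$ is the algorithm's output) obtained with this choice of $c$ and $C_1$.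
   Context: The Select Maximum Valid Index algorithm takes as input two strictly increasing real arrays $u[1],\dots,u[n]$ and $c[1],\dots,c[n]$ and a constant $C > 0$. It initializes $\mathrm{mark}[j] = 1$ for all $j \in \{1,\dots,n\}$. For every pair $1 \le i < j \le n$ with $\frac{u[j]-u[i]}{c[j]-c[i]} < C$, it sets $\mathrm{mark}[j] = 0$. It outputs $\max\{ j : \mathrm{mark}[j] = 1\}$. Equivalently, the output is the largest $j \in \{1,\dots,n\}$ such that $\frac{u[j]-u[i]}{c[j]-c[i]} \ge C$ for all $1 \le i < j$ (the condition is vacuous for $j=1$). In a tree-structured draft for speculative decoding, a batch of $B$ samples is processed, and in a given layer each sample has $N$ candidate nodes. Each node carries a confidence score, namely the product of the draft model's conditional token probabilities along the path from the root to the node. The general selection rule retains, for each sample, the $n$ nodes with the highest confidence scores, where $n$ is the output of the algorithm above applied to a utility array $u$, a cost array $c$ and a threshold $C_1$. The EAGLE-2/EAGLE-3 rule retains, for each sample, the $K$ nodes with the highest confidence scores in the layer, for a fixed hyperparameter $K$.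
   Formalization: Adds the assumption that if K < N then v^(j)(K+1) < v^(j)(K) for at least one sample j; without it the claim is false (B=1, N=2, K=1, both scores 1/2, λ=1, δ=0 gives output 2), and whenever it fails the output exceeds K. *)

theory Defs
  imports Complex_Main
begin

text \<open>
  Arrays are functions on \<^typ>\<open>nat\<close> of which only the indices \<open>1, \<dots>, n\<close> are used.
\<close>

definition index_pairs :: "nat \<Rightarrow> (nat \<times> nat) list" where
  "index_pairs n = [(i, j). j \<leftarrow> [1..<Suc n], i \<leftarrow> [1..<j]]"

definition smvi_step ::
  "(nat \<Rightarrow> real) \<Rightarrow> (nat \<Rightarrow> real) \<Rightarrow> real \<Rightarrow> nat \<times> nat \<Rightarrow> (nat \<Rightarrow> nat) \<Rightarrow> nat \<Rightarrow> nat" where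
  "smvi_step u c C = (\<lambda>(i, j) mark.
     if (u j - u i) / (c j - c i) < C then mark(j := 0) else mark)"

definition smvi_marks ::
  "nat \<Rightarrow> (nat \<Rightarrow> real) \<Rightarrow> (nat \<Rightarrow> real) \<Rightarrow> real \<Rightarrow> nat \<Rightarrow> nat" where
  "smvi_marks n u c C = fold (smvi_step u c C) (index_pairs n) (\<lambda>_. 1)"

definition select_max_valid_index ::
  "nat \<Rightarrow> (nat \<Rightarrow> real) \<Rightarrow> (nat \<Rightarrow> real) \<Rightarrow> real \<Rightarrow> nat" where
  "select_max_valid_index n u c C = Max {j \<in> {1..n}. smvi_marks n u c C j = 1}"

text \<open>
  Retaining the \<open>n\<close> highest-scoring nodes of \<open>A\<close> is a relation between \<open>A\<close> and the retained set:
  when scores tie at the cut, several sets qualify and no tie-breaking is prescribed.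
\<close>

definition retains_top :: "('a \<Rightarrow> real) \<Rightarrow> 'a set \<Rightarrow> nat \<Rightarrow> 'a set \<Rightarrow> bool" where
  "retains_top score A n R \<longleftrightarrow>
     R \<subseteq> A \<and> card R = n \<and> (\<forall>x\<in>R. \<forall>y\<in>A - R. score y \<le> score x)"

text \<open>
  A layer selection \<open>R\<close> assigns to each sample \<open>j\<close> in \<open>{1..B}\<close> the set \<open>R j\<close> of nodes retained
  among its candidates \<open>cand j\<close>.
\<close>

definition algorithm_selection ::
  "nat \<Rightarrow> nat \<Rightarrow> (nat \<Rightarrow> 'a set) \<Rightarrow> (nat \<Rightarrow> 'a \<Rightarrow> real) \<Rightarrow>
   (nat \<Rightarrow> real) \<Rightarrow> (nat \<Rightarrow> real) \<Rightarrow> real \<Rightarrow> (nat \<Rightarrow> 'a set) \<Rightarrow> bool" where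
  "algorithm_selection B N cand score u c C R \<longleftrightarrow>
     (\<forall>j\<in>{1..B}. retains_top (score j) (cand j) (select_max_valid_index N u c C) (R j))"

definition eagle_selection ::
  "nat \<Rightarrow> (nat \<Rightarrow> 'a set) \<Rightarrow> (nat \<Rightarrow> 'a \<Rightarrow> real) \<Rightarrow> nat \<Rightarrow> (nat \<Rightarrow> 'a set) \<Rightarrow> bool" where
  "eagle_selection B cand score K R \<longleftrightarrow>
     (\<forall>j\<in>{1..B}. retains_top (score j) (cand j) K (R j))"

end

theory Submission
  imports Defs
begin

text \<open>
  The slope of \<open>u\<close> against the affine \<open>c\<close> between \<open>i < j\<close> is \<open>1 / lam\<close> times the average of the
  increments of \<open>u\<close> over \<open>i < s \<le> j\<close>. The increments are non-increasing, so for \<open>j \<le> K\<close> every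
  such average is at least the \<open>K\<close>-th increment \<open>C1 * lam\<close>, and \<open>K\<close> stays marked. For \<open>j > K\<close> the
  single pair \<open>(j - 1, j)\<close> already has a slope below \<open>C1\<close>, because the increments drop strictly
  after \<open>K\<close>.
\<close>

lemma set_index_pairs: "set (index_pairs n) = {(i, j). 1 \<le> i \<and> i < j \<and> j \<le> n}"
  by (auto simp: index_pairs_def image_iff simp del: upt_Suc)

text \<open>A step only ever writes 0 and its test never reads \<open>mark\<close>, so the order of
  the pairs is immaterial. The initial \<open>mark\<close> is arbitrary because the induction passes
  through updated ones.\<close>

lemma fold_smvi_step_eq_1_iff:
  "fold (smvi_step u c C) ps mark j = 1 \<longleftrightarrow>
     mark j = 1 \<and> (\<forall>i. (i, j) \<in> set ps \<longrightarrow> C \<le> (u j - u i) / (c j - c i))"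
  by (induction ps arbitrary: mark) (auto simp: smvi_step_def not_less split: if_splits)

lemma smvi_marks_eq_1_iff:
  assumes "j \<le> n"
  shows "smvi_marks n u c C j = 1 \<longleftrightarrow> (\<forall>i\<in>{1..<j}. C \<le> (u j - u i) / (c j - c i))"
  using assms by (auto simp: smvi_marks_def fold_smvi_step_eq_1_iff set_index_pairs simp del: One_nat_def)

lemma select_max_valid_index_eqI:
  assumes "k \<in> {1..n}"
    and "\<And>i. i \<in> {1..<k} \<Longrightarrow> C \<le> (u k - u i) / (c k - c i)"
    and "\<And>j. j \<in> {k<..n} \<Longrightarrow> \<exists>i\<in>{1..<j}. (u j - u i) / (c j - c i) < C"
  shows "select_max_valid_index n u c C = k"
  unfolding select_max_valid_index_def
proof (rule Max_eqI)
  show "k \<in> {j \<in> {1..n}. smvi_marks n u c C j = 1}"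
    using assms(1,2) by (simp add: smvi_marks_eq_1_iff del: One_nat_def)
  show "j \<le> k" if "j \<in> {j \<in> {1..n}. smvi_marks n u c C j = 1}" for j
  proof (rule ccontr)
    assume "\<not> j \<le> k"
    then obtain i where "i \<in> {1..<j}" "(u j - u i) / (c j - c i) < C"
      using assms(3)[of j] \<open>j \<in> _\<close> by auto
    then show False
      using \<open>j \<in> _\<close> by (auto simp: smvi_marks_eq_1_iff simp del: One_nat_def dest!: bspec[of _ _ i])
  qed
qed simp

text \<open>The batch enters only through the increments \<open>d\<close> of \<open>u\<close>. The
  drop is guarded by \<open>k < n\<close> because \<open>d\<close> is unconstrained beyond
  \<open>n\<close>.\<close>

lemma select_max_valid_index_concave:
  fixes d u c :: "nat \<Rightarrow> real"
  assumes k: "k \<in> {1..n}" and lam: "lam > 0"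
    and u: "\<And>j. j \<in> {1..n} \<Longrightarrow> u j = (\<Sum>s = 1..j. d s)"
    and c: "\<And>j. j \<in> {1..n} \<Longrightarrow> c j = lam * real j + \<delta>"
    and anti: "antimono_on {1..n} d"
    and drop: "k < n \<Longrightarrow> d (k + 1) < d k"
  shows "select_max_valid_index n u c (d k / lam) = k"
proof (rule select_max_valid_index_eqI[OF k])
  \<comment> \<open>The offset \<open>\<delta>\<close> cancels in \<open>c j - c i\<close>.\<close>
  have slope: "(u j - u i) / (c j - c i) = (\<Sum>s = i + 1..j. d s) / (lam * real (j - i))"
    if "i \<in> {1..<j}" "j \<in> {1..n}" for i j
  proof -
    have "(\<Sum>s = 1..j. d s) = (\<Sum>s = 1..i. d s) + (\<Sum>s = i + 1..j. d s)"
      using that sum.ub_add_nat[of 1 i d "j - i"] by simp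
    then show ?thesis
      using that by (simp add: u c of_nat_diff right_diff_distrib)
  qed
  show "d k / lam \<le> (u k - u i) / (c k - c i)" if i: "i \<in> {1..<k}" for i
  proof -
    have "real (card {i + 1..k}) * d k \<le> (\<Sum>s = i + 1..k. d s)"
      using i k anti by (intro sum_bounded_below) (auto simp: monotone_on_def)
    then have "real (k - i) * d k \<le> (\<Sum>s = i + 1..k. d s)"
      by simp
    \<comment> \<open>The factor \<open>real (k - i)\<close> stays uncancelled on the left to match
      the denominator in \<open>slope\<close>.\<close>
    then have "real (k - i) * d k / (lam * real (k - i)) \<le> (u k - u i) / (c k - c i)"
      unfolding slope[OF i k] using lam by (intro divide_right_mono) auto
    then show ?thesis
      using i by simp
  qed
  show "\<exists>i\<in>{1..<j}. (u j - u i) / (c j - c i) < d k / lam" if j: "j \<in> {k<..n}" for j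
  proof
    \<comment> \<open>As \<open>j > k\<close> and \<open>k \<ge> 1\<close>, the predecessor of
      \<open>j\<close> is a genuine index.\<close>
    show i: "j - 1 \<in> {1..<j}"
      using j k by auto
    have "d j \<le> d (k + 1)"
      using j k anti by (auto simp: monotone_on_def)
    also have "\<dots> < d k"
      using j drop by simp
    finally have "d j / lam < d k / lam"
      using lam by (simp add: divide_strict_right_mono)
    then show "(u j - u (j - 1)) / (c j - c (j - 1)) < d k / lam"
      using slope[OF i] j k by simp
  qed
qed

text \<open>If all samples tied at ranks \<open>K\<close> and \<open>K + 1\<close>, every slope into
  \<open>K + 1\<close> would be at least \<open>C1\<close> and the output would exceed
  \<open>K\<close>; \<open>no_full_tie\<close> excludes this.\<close>

theorem theorem4p1:
  fixes B N K :: nat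
    and cand :: "nat \<Rightarrow> 'a set"
    and score :: "nat \<Rightarrow> 'a \<Rightarrow> real"
    and node :: "nat \<Rightarrow> nat \<Rightarrow> 'a"
    and v :: "nat \<Rightarrow> nat \<Rightarrow> real"
    and u c :: "nat \<Rightarrow> real"
    and lam \<delta> C1 :: real
  assumes "B \<ge> 1" and "N \<ge> 1" and "K \<ge> 1" and "K \<le> N"
    and nodes: "\<And>j. j \<in> {1..B} \<Longrightarrow> bij_betw (node j) {1..N} (cand j)"
    and scores: "\<And>j s. j \<in> {1..B} \<Longrightarrow> s \<in> {1..N} \<Longrightarrow> v j s = score j (node j s)"
    and range: "\<And>j s. j \<in> {1..B} \<Longrightarrow> s \<in> {1..N} \<Longrightarrow> v j s \<in> {0..1}"
    and sorted: "\<And>j s t. j \<in> {1..B} \<Longrightarrow> s \<in> {1..N} \<Longrightarrow> t \<in> {1..N} \<Longrightarrow> s \<le> t \<Longrightarrow> v j t \<le> v j s"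
    and u: "\<And>k. k \<in> {1..N} \<Longrightarrow> u k = (1 / real B) * (\<Sum>j = 1..B. \<Sum>s = 1..k. v j s)"
    and u_strict: "strict_mono_on {1..N} u"
    and "lam > 0"
    and c: "\<And>k. k \<in> {1..N} \<Longrightarrow> c k = lam * real k + \<delta>"
    and C1: "C1 = (\<Sum>j = 1..B. v j K) / (real B * lam)"
    and no_full_tie: "K < N \<Longrightarrow> \<exists>j\<in>{1..B}. v j (K + 1) < v j K"
  shows "select_max_valid_index N u c C1 = K
    \<and> (\<forall>R. algorithm_selection B N cand score u c C1 R \<longleftrightarrow> eagle_selection B cand score K R)"
proof -
  \<comment> \<open>The batch mean of the rank-\<open>s\<close> scores: swapping the two sums shows
    that it is the increment of \<open>u\<close> at \<open>s\<close>.\<close>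
  define d where "d s = (1 / real B) * (\<Sum>j = 1..B. v j s)" for s
  have "select_max_valid_index N u c (d K / lam) = K"
  proof (rule select_max_valid_index_concave)
    show "K \<in> {1..N}"
      using \<open>K \<ge> 1\<close> \<open>K \<le> N\<close> by simp
    show "u k = (\<Sum>s = 1..k. d s)" if "k \<in> {1..N}" for k
      unfolding u[OF that] d_def by (subst sum.swap) (simp add: sum_distrib_left)
    show "antimono_on {1..N} d"
      using sorted by (auto simp: monotone_on_def d_def intro!: divide_right_mono sum_mono)
    show "d (K + 1) < d K" if "K < N"
    proof -
      \<comment> \<open>One strict sample suffices, since no other sample increases.\<close>
      have "(\<Sum>j = 1..B. v j (K + 1)) < (\<Sum>j = 1..B. v j K)"
        using no_full_tie[OF that] that \<open>K \<ge> 1\<close>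
        by (intro sum_strict_mono_ex1) (auto intro!: sorted)
      then show ?thesis
        unfolding d_def using \<open>B \<ge> 1\<close> by (intro mult_strict_left_mono) auto
    qed
  qed (use \<open>lam > 0\<close> c in auto)
  moreover have "d K / lam = C1"
    by (simp add: d_def C1)
  ultimately show ?thesis
    by (simp add: algorithm_selection_def eagle_selection_def)
qed

end
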